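(* Let $k\ge 1$ and $n\geq 1$ be integers, and let $X_n$ denote the set of all subsets $X\subset\mathbb{Z}^k$ of size $n$. Define $f:X_n\to\mathbb{R}$ by $$f(X) = \sum_{I\subset\{1,2,\dots,k\}} 2^{|I|}\,|P_I(X)|.$$ Then the minimum value of $f$ is achieved at the initial segment of $\mathbb{Z}^k$ of size $n$ with respect to the well-ordering $\prec$.
   Context: For $I\subset\{1,\dots,k\}$ and $X\subset\mathbb{Z}^k$, $P_I(X)$ is the $(k-|I|)$-dimensional projection of $X$ obtained by deleting the coordinates in $I$ (when $I=\{1,\dots,k\}$ and $X\ne\emptyset$, $P_I(X)$ is a single point, so $|P_I(X)|=1$). The sum is over all subsets $I$, including the empty and full ones. The well-ordering $\prec$ on $\mathbb{Z}^k$ is defined inductively. On $\mathbb{Z}^1=\mathbb{Z}$ it is $0 \prec 1 \prec -1 \prec 2 \prec -2 \prec 3 \prec \cdots$. For $k>1$ and $u=(u_1,\dots,u_k)\in\mathbb{Z}^k$, let $M(u)$ be the maximum of $\{u_1,\dots,u_k\}$ with respect to $\prec$ on $\mathbb{Z}$, and $i_u = \min\{i : u_i = M(u)\}$. For $u \ne v$ in $\mathbb{Z}^k$: (1) if $M(u) \prec M(v)$ then $u \prec v$; (2) if $M(u)=M(v)$ and $i_v < i_u$ then $u \prec v$; (3) if $M(u)=M(v)$ and $i_u=i_v$, let $u', v' \in \mathbb{Z}^{k-1}$ be obtained from $u,v$ by deleting the $i_u$-th coordinate; then $u \prec v$ if and only if $u' \prec v'$ in $\mathbb{Z}^{k-1}$.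 An initial segment of $\mathbb{Z}^k$ is a subset $I$ such that $v\in I$ and $u \prec v$ imply $u \in I$; the initial segment of size $n$ consists of the first $n$ elements under $\prec$. *)

theory Defs
  imports Complex_Main
begin

text \<open>Points of \<open>\<int>\<^sup>k\<close> are integer lists of length \<open>k\<close>. Coordinates are counted from 0,
  so the index set is \<open>{..<k}\<close>.\<close>

definition lattice :: "nat \<Rightarrow> int list set" where
  "lattice k = {u. length u = k}"

definition proj :: "nat set \<Rightarrow> int list set \<Rightarrow> int list set" where
  "proj I X = (\<lambda>u. nths u (- I)) ` X"

definition n_subsets :: "nat \<Rightarrow> nat \<Rightarrow> int list set set" where
  "n_subsets k n = {X. X \<subseteq> lattice k \<and> finite X \<and> card X = n}"

definition weighted_proj_sum :: "nat \<Rightarrow> int list set \<Rightarrow> real" where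
  "weighted_proj_sum k X = (\<Sum>I\<in>Pow {..<k}. 2 ^ card I * real (card (proj I X)))"

text \<open>The order \<open>0, 1, -1, 2, -2, 3, \<dots>\<close> on the integers.\<close>

definition int_prec :: "int \<Rightarrow> int \<Rightarrow> bool" where
  "int_prec a b \<longleftrightarrow> \<bar>a\<bar> < \<bar>b\<bar> \<or> \<bar>a\<bar> = \<bar>b\<bar> \<and> b < a"

definition max_entry :: "int list \<Rightarrow> int" where
  "max_entry u = (THE m. m \<in> set u \<and> (\<forall>x\<in>set u. x = m \<or> int_prec x m))"

definition max_index :: "int list \<Rightarrow> nat" where
  "max_index u = (LEAST i. i < length u \<and> u ! i = max_entry u)"

definition delete_coord :: "nat \<Rightarrow> int list \<Rightarrow> int list" where
  "delete_coord i u = take i u @ drop (Suc i) u"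

text \<open>\<open>prec k\<close> is meant for arguments in \<open>lattice k\<close>; the value at dimension 0 is never used
  by the recursion. Note the reversed comparison of indices: a later first position of the
  maximum makes the point smaller.\<close>

fun prec :: "nat \<Rightarrow> int list \<Rightarrow> int list \<Rightarrow> bool" where
  "prec 0 u v \<longleftrightarrow> False"
| "prec (Suc 0) u v \<longleftrightarrow> int_prec (u ! 0) (v ! 0)"
| "prec (Suc (Suc k)) u v \<longleftrightarrow>
     int_prec (max_entry u) (max_entry v) \<or>
     max_entry u = max_entry v \<and> max_index v < max_index u \<or>
     max_entry u = max_entry v \<and> max_index u = max_index v \<and>
       prec (Suc k) (delete_coord (max_index u) u) (delete_coord (max_index v) v)"

definition initial_segment :: "nat \<Rightarrow> int list set \<Rightarrow> bool" where
  "initial_segment k S \<longleftrightarrow>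
     S \<subseteq> lattice k \<and> (\<forall>v\<in>S. \<forall>u\<in>lattice k. prec k u v \<longrightarrow> u \<in> S)"

end

theory Submission
  imports Defs
begin

text \<open>Ranking the integers as \<open>0, 1, -1, 2, \<dots>\<close> replaces \<open>\<int>\<^sup>k\<close> by \<open>\<nat>\<^sup>k\<close> and does not change the
  sizes of projections. The order then has a description without recursion: regard a point as the set of its
  pairs of an entry and a position, ordered by entry and, for equal entries, by decreasing position. The
  greatest pair in which two points differ belongs to the later point (\<open>prec_iff_colex_less\<close>). This is the
  colexicographic order of sets, hence the order of binary numerals (\<open>code\<close>). Coordinates on which two points
  agree cancel, so all slices inherit the order.

  Shifting points towards the origin does not enlarge any projection (\<open>down_closed_reduction\<close>), so it is enough
  to consider down-closed sets. There the sum over the projections equals the sum of \<open>3\<^sup>z\<close> over the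
  points, where \<open>z\<close> is the number of zero coordinates (\<open>projection_sum_down_closed\<close>).

  For this weight the proof is by induction on the dimension and, within a dimension, on the sum of the codes: a
  down-closed set that is not an initial segment can be changed, without increasing the weight, into a
  down-closed set of the same size with smaller sum of codes (\<open>nonsegment_improvable\<close>). If some slice is not an initial
  segment, all parallel slices are replaced by initial segments (\<open>compression_improves\<close>). If all slices are initial
  segments, the least missing point \<open>u\<close> and the greatest present point \<open>v\<close> differ everywhere, and \<open>u\<close> has at most one
  zero. Either \<open>v\<close> may be exchanged for \<open>u\<close>, or a line of points ending in \<open>v\<close> for a line of equally many points
  starting at \<open>u\<close>.\<close>

section \<open>The order on \<open>\<nat>\<^sup>A\<close> as a binary numeral\<close>

text \<open>Points are functions that vanish off the coordinate set \<open>A\<close>. Then a slice and a projection of a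
  set of points consist of points of the same type, and the dimension can vary in an induction.\<close>
definition orthant :: "nat set \<Rightarrow> (nat \<Rightarrow> nat) set" where
  "orthant A = {x. \<forall>l. l \<notin> A \<longrightarrow> x l = 0}"

text \<open>The pair of an entry \<open>a\<close> and its position \<open>l\<close>, packed into one number: larger entries come later,
  and among equal entries the smaller position comes later. \<open>K\<close> bounds all positions in use.\<close>
definition key :: "nat \<Rightarrow> nat \<Rightarrow> nat \<Rightarrow> nat" where
  "key K l a = K * a + (K - 1 - l)"

text \<open>The binary numeral of the set of packed pairs of \<open>x\<close>. The colexicographic order of sets is the order
  of these numerals, and a coordinate shared by two points contributes the same summand to both.\<close>
definition code :: "nat \<Rightarrow> (nat \<Rightarrow> nat) \<Rightarrow> nat" where
  "code K x = (\<Sum>l<K. 2 ^ key K l (x l))"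

lemma key_mono: "a \<le> b \<Longrightarrow> key K l a \<le> key K l b"
  unfolding key_def by (intro add_right_mono mult_le_mono2)

lemma key_less_if_entry_less:
  assumes "l < K" "a < b"
  shows "key K l a < key K j b"
proof -
  have "K * a + K \<le> K * b"
    using mult_le_mono2[of "Suc a" b K] assms(2) by simp
  then show ?thesis using assms(1) by (simp add: key_def)
qed

lemma key_less_iff:
  assumes "l < K" "j < K"
  shows "key K l a < key K j b \<longleftrightarrow> a < b \<or> a = b \<and> j < l"
proof (cases a b rule: linorder_cases)
  case equal
  then show ?thesis using assms by (auto simp: key_def)
next
  case less
  then show ?thesis using key_less_if_entry_less[OF assms(1) less] by simp
next
  case greater
  then show ?thesis using key_less_if_entry_less[OF assms(2) greater, of l] by simp
qed

lemma key_eq_iff: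
  assumes "l < K" "j < K"
  shows "key K l a = key K j b \<longleftrightarrow> a = b \<and> l = j"
  using key_less_iff[OF assms, of a b] key_less_iff[OF assms(2,1), of b a] by force

text \<open>The largest packed pair of \<open>y\<close> outweighs all differing pairs of \<open>x\<close> together, because those have
  distinct smaller exponents and the powers of two below \<open>2\<^sup>n\<close> sum to less than \<open>2\<^sup>n\<close>.\<close>
lemma code_lessI:
  assumes "j < K" "x j \<noteq> y j"
    and key: "\<And>l. l < K \<Longrightarrow> x l \<noteq> y l \<Longrightarrow> key K l (x l) < key K j (y j)"
  shows "code K x < code K y"
proof -
  have sum_powers: "(\<Sum>e<n. 2 ^ e) < (2::nat) ^ n" for n by (induction n) auto
  define D where "D = {l. l < K \<and> x l \<noteq> y l}"
  have split: "code K z = (\<Sum>l\<in>D. 2 ^ key K l (z l)) + (\<Sum>l\<in>{..<K} - D. 2 ^ key K l (z l))" for z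
    unfolding code_def by (subst sum.subset_diff[of D]) (auto simp: D_def)
  have "inj_on (\<lambda>l. key K l (x l)) D"
    by (rule inj_onI) (simp add: D_def key_eq_iff)
  then have "(\<Sum>l\<in>D. 2 ^ key K l (x l)) = (\<Sum>e\<in>(\<lambda>l. key K l (x l)) ` D. (2::nat) ^ e)"
    by (simp add: sum.reindex)
  also have "\<dots> \<le> (\<Sum>e<key K j (y j). 2 ^ e)"
    by (rule sum_mono2) (auto simp: D_def key)
  also have "\<dots> < 2 ^ key K j (y j)"
    using sum_powers[of "key K j (y j)"] .
  also have "\<dots> \<le> (\<Sum>l\<in>D. 2 ^ key K l (y l))"
    using assms(1,2) by (intro member_le_sum[of j D]) (auto simp: D_def)
  finally have "(\<Sum>l\<in>D. 2 ^ key K l (x l)) < (\<Sum>l\<in>D. (2::nat) ^ key K l (y l))" .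
  moreover have "(\<Sum>l\<in>{..<K} - D. 2 ^ key K l (x l)) = (\<Sum>l\<in>{..<K} - D. (2::nat) ^ key K l (y l))"
    by (rule sum.cong) (auto simp: D_def)
  ultimately show ?thesis by (simp add: split)
qed

lemma top_difference_exists:
  assumes "l < K" "x l \<noteq> y l"
  obtains j where "j < K" "x j \<noteq> y j"
    and "(\<forall>l<K. x l \<noteq> y l \<longrightarrow> key K l (x l) < key K j (y j)) \<or>
         (\<forall>l<K. x l \<noteq> y l \<longrightarrow> key K l (y l) < key K j (x j))"
proof -
  define D where "D = {l. l < K \<and> x l \<noteq> y l}"
  define h where "h = (\<lambda>l. max (key K l (x l)) (key K l (y l)))"
  have "finite D" "D \<noteq> {}" using assms by (auto simp: D_def)
  then have "Max (h ` D) \<in> h ` D" by simp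
  then obtain j where j: "j \<in> D" and "Max (h ` D) = h j" by blast
  with \<open>finite D\<close> have top: "h l \<le> h j" if "l \<in> D" for l
    using Max_ge[of "h ` D" "h l"] that by simp
  have jK: "j < K" "x j \<noteq> y j" using j by (auto simp: D_def)
  have less: "key K l (x l) < key K j (y j)"
    if "x j < y j" "l < K" "x l \<noteq> y l" for l
  proof -
    have "h j = key K j (y j)"
      using that jK by (simp add: h_def max_def key_def)
    then have "key K l (x l) \<le> key K j (y j)" using top[of l] that by (simp add: D_def h_def)
    moreover have "key K l (x l) \<noteq> key K j (y j)"
      using that jK by (auto simp: key_eq_iff)
    ultimately show ?thesis by simp
  qed
  have greater: "key K l (y l) < key K j (x j)"
    if "y j < x j" "l < K" "x l \<noteq> y l" for l
  proof -
    have "h j = key K j (x j)"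
      using that jK by (simp add: h_def max_def key_def)
    then have "key K l (y l) \<le> key K j (x j)" using top[of l] that by (simp add: D_def h_def)
    moreover have "key K l (y l) \<noteq> key K j (x j)"
      using that jK by (auto simp: key_eq_iff)
    ultimately show ?thesis by simp
  qed
  have "x j < y j \<or> y j < x j" using jK(2) by linarith
  then show ?thesis using that[OF jK] less greater by blast
qed

lemma code_less_iff:
  "code K x < code K y \<longleftrightarrow>
    (\<exists>j<K. x j \<noteq> y j \<and> (\<forall>l<K. x l \<noteq> y l \<longrightarrow> key K l (x l) < key K j (y j)))"
proof
  assume less: "code K x < code K y"
  have "\<exists>l<K. x l \<noteq> y l"
  proof (rule ccontr)
    assume "\<not> (\<exists>l<K. x l \<noteq> y l)"
    then have "code K x = code K y" unfolding code_def by (intro sum.cong) auto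
    with less show False by simp
  qed
  then obtain j where j: "j < K" "x j \<noteq> y j"
    and top: "(\<forall>l<K. x l \<noteq> y l \<longrightarrow> key K l (x l) < key K j (y j)) \<or>
         (\<forall>l<K. x l \<noteq> y l \<longrightarrow> key K l (y l) < key K j (x j))"
    using top_difference_exists by metis
  have "\<not> (\<forall>l<K. x l \<noteq> y l \<longrightarrow> key K l (y l) < key K j (x j))"
  proof
    assume "\<forall>l<K. x l \<noteq> y l \<longrightarrow> key K l (y l) < key K j (x j)"
    then have "code K y < code K x" using j by (intro code_lessI[of j]) auto
    with less show False by simp
  qed
  with j top show "\<exists>j<K. x j \<noteq> y j \<and> (\<forall>l<K. x l \<noteq> y l \<longrightarrow> key K l (x l) < key K j (y j))"
    by blast
qed (use code_lessI in blast)

lemma code_inj: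
  assumes "A \<subseteq> {..<K}" "x \<in> orthant A" "y \<in> orthant A" "code K x = code K y"
  shows "x = y"
proof (rule ccontr)
  assume "x \<noteq> y"
  then obtain l where l: "x l \<noteq> y l" by blast
  with assms have "l < K" by (force simp: orthant_def)
  with l obtain j where j: "j < K" "x j \<noteq> y j"
    and top: "(\<forall>l<K. x l \<noteq> y l \<longrightarrow> key K l (x l) < key K j (y j)) \<or>
         (\<forall>l<K. x l \<noteq> y l \<longrightarrow> key K l (y l) < key K j (x j))"
    using top_difference_exists by metis
  from top have "code K x < code K y \<or> code K y < code K x"
  proof
    assume "\<forall>l<K. x l \<noteq> y l \<longrightarrow> key K l (x l) < key K j (y j)"
    then show ?thesis using j by (intro disjI1 code_lessI[of j]) auto
  next
    assume "\<forall>l<K. x l \<noteq> y l \<longrightarrow> key K l (y l) < key K j (x j)"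
    then show ?thesis using j by (intro disjI2 code_lessI[of j]) auto
  qed
  with assms(4) show False by simp
qed

lemma code_mono: "x \<le> y \<Longrightarrow> code K x \<le> code K y"
  unfolding code_def by (intro sum_mono power_increasing) (auto simp: key_mono le_fun_def)

lemma code_strict_mono:
  assumes "x \<le> y" "l < K" "x l < y l"
  shows "code K x < code K y"
  unfolding code_def
proof (rule sum_strict_mono_ex1)
  show "\<forall>l\<in>{..<K}. (2::nat) ^ key K l (x l) \<le> 2 ^ key K l (y l)"
    using assms(1) by (auto simp: key_mono le_fun_def)
  show "\<exists>l\<in>{..<K}. (2::nat) ^ key K l (x l) < 2 ^ key K l (y l)"
    using assms(2,3) by (intro bexI[of _ l]) (auto simp: key_less_iff)
qed simp

section \<open>Initial segments and down-closed sets\<close>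

definition segment :: "nat \<Rightarrow> nat set \<Rightarrow> (nat \<Rightarrow> nat) set \<Rightarrow> bool" where
  "segment K A S \<longleftrightarrow> S \<subseteq> orthant A \<and>
     (\<forall>v\<in>S. \<forall>u\<in>orthant A. code K u < code K v \<longrightarrow> u \<in> S)"

definition down_closed :: "(nat \<Rightarrow> nat) set \<Rightarrow> bool" where
  "down_closed X \<longleftrightarrow> (\<forall>x\<in>X. \<forall>d\<le>x. d \<in> X)"

lemma orthant_le: "x \<in> orthant A \<Longrightarrow> d \<le> x \<Longrightarrow> d \<in> orthant A"
  unfolding orthant_def le_fun_def by (simp, metis le_zero_eq)

lemma orthant_less_coord:
  assumes "x \<in> orthant A" "d \<le> x" "d \<noteq> x"
  obtains l where "l \<in> A" "d l < x l"
proof -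
  obtain l where "d l \<noteq> x l" using assms(3) by blast
  then have less: "d l < x l" using assms(2) by (auto simp: le_fun_def intro: le_neq_implies_less)
  have "l \<in> A"
  proof (rule ccontr)
    assume "l \<notin> A"
    then have "x l = 0" using assms(1) by (simp add: orthant_def)
    with less show False by simp
  qed
  then show ?thesis using that less by blast
qed

lemma segment_down_closed:
  assumes A: "A \<subseteq> {..<K}" and S: "segment K A S"
  shows "down_closed S"
  unfolding down_closed_def
proof (intro ballI allI impI)
  fix x d assume x: "x \<in> S" "d \<le> x"
  then have xA: "x \<in> orthant A" using S by (auto simp: segment_def)
  show "d \<in> S"
  proof (cases "d = x")
    case False
    then obtain l where "l \<in> A" "d l < x l" using orthant_less_coord[OF xA x(2)] by metis
    then have "code K d < code K x" using code_strict_mono[OF x(2)] A by blast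
    then show ?thesis using S x orthant_le[OF xA x(2)] unfolding segment_def by blast
  qed (use x in simp)
qed

lemma segment_nested:
  assumes A: "A \<subseteq> {..<K}" and S: "segment K A S" and T: "segment K A T"
    and "finite S" "finite T" "card S \<le> card T"
  shows "S \<subseteq> T"
proof (rule ccontr)
  assume "\<not> S \<subseteq> T"
  then obtain s where s: "s \<in> S" "s \<notin> T" by blast
  have "t \<in> S" if t: "t \<in> T" for t
  proof -
    have "t \<in> orthant A" "s \<in> orthant A" using s t S T by (auto simp: segment_def)
    then show ?thesis
      using s t S T code_inj[OF A, of s t] unfolding segment_def
      by (cases "code K s" "code K t" rule: linorder_cases) auto
  qed
  with s have "T \<subset> S" by blast
  from psubset_card_mono[OF \<open>finite S\<close> this] assms(6) show False by simp
qed

lemma infinite_orthant: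
  assumes "A \<noteq> {}"
  shows "infinite (orthant A)"
proof
  assume fin: "finite (orthant A)"
  obtain i where i: "i \<in> A" using assms by blast
  have "inj (\<lambda>c::nat. (\<lambda>_. 0::nat)(i := c))" by (rule injI) (metis fun_upd_same)
  moreover have "range (\<lambda>c::nat. (\<lambda>_. 0::nat)(i := c)) \<subseteq> orthant A"
    using i by (auto simp: orthant_def)
  ultimately show False
    using fin finite_subset finite_imageD infinite_UNIV_nat by metis
qed

text \<open>Add the least missing point, over and over.\<close>
lemma segment_exists:
  assumes A: "A \<subseteq> {..<K}" "A \<noteq> {}"
  shows "\<exists>S. segment K A S \<and> finite S \<and> card S = n"
proof (induction n)
  case 0
  show ?case by (intro exI[of _ "{}"]) (simp add: segment_def)
next
  case (Suc n)
  then obtain S where S: "segment K A S" "finite S" "card S = n" by blast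
  have "orthant A - S \<noteq> {}"
    using infinite_orthant[OF A(2)] S(2) by (metis finite.emptyI finite_Diff2)
  then obtain u where u: "u \<in> orthant A - S"
    and least: "\<And>w. w \<in> orthant A - S \<Longrightarrow> code K u \<le> code K w"
    using ex_has_least_nat[of "\<lambda>w. w \<in> orthant A - S" _ "code K"] by auto
  have "segment K A (insert u S)"
    using S(1) u least unfolding segment_def by (auto simp: not_le[symmetric])
  then show ?case using S u by (intro exI[of _ "insert u S"]) auto
qed

text \<open>Match the points of \<open>S - T\<close> with those of \<open>T - S\<close>: in every matched pair the point of the
  segment comes first.\<close>
lemma segment_code_sum:
  assumes A: "A \<subseteq> {..<K}" and S: "segment K A S" and T: "T \<subseteq> orthant A"
    and fin: "finite S" "finite T" and card: "card S = card T"
  shows "sum (code K) S \<le> sum (code K) T"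
    and "S \<noteq> T \<Longrightarrow> sum (code K) S < sum (code K) T"
proof -
  have "card (S - T) = card (T - S)"
    using card card_le_sym_Diff[OF fin] card_le_sym_Diff[OF fin(2,1)] by simp
  then obtain h where h: "bij_betw h (S - T) (T - S)"
    using finite_same_card_bij fin by blast
  have less: "code K s < code K (h s)" if "s \<in> S - T" for s
  proof -
    have hs: "h s \<in> T - S" using h that by (auto dest: bij_betwE)
    then have "s \<noteq> h s" "s \<in> orthant A" "h s \<in> orthant A"
      using that S T by (auto simp: segment_def)
    then show ?thesis
      using that hs S code_inj[OF A, of s "h s"] unfolding segment_def
      by (cases "code K s" "code K (h s)" rule: linorder_cases) auto
  qed
  have split: "sum (code K) S = sum (code K) (S \<inter> T) + sum (code K) (S - T)"
      "sum (code K) T = sum (code K) (S \<inter> T) + sum (\<lambda>s. code K (h s)) (S - T)"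
    using fin sum.Int_Diff[of S "code K" T] sum.Int_Diff[of T "code K" S]
      sum.reindex_bij_betw[OF h, of "code K"] by (auto simp: Int_commute)
  show "sum (code K) S \<le> sum (code K) T"
    unfolding split using less by (intro add_left_mono sum_mono) (simp add: less_imp_le)
  assume "S \<noteq> T"
  then have "S - T \<noteq> {}"
    using \<open>card (S - T) = card (T - S)\<close> fin by (metis Diff_eq_empty_iff card_0_eq card.empty finite_Diff subset_antisym)
  then show "sum (code K) S < sum (code K) T"
    unfolding split using less fin by (intro add_strict_left_mono sum_strict_mono) auto
qed

section \<open>Shifting to a down-closed set\<close>

text \<open>Overwriting entries by \<open>0\<close> stands for deleting them: it identifies the same points, and the
  projections of a down-closed set become subsets of it.\<close>
definition zero_out :: "nat set \<Rightarrow> (nat \<Rightarrow> nat) \<Rightarrow> nat \<Rightarrow> nat" where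
  "zero_out I x = (\<lambda>l. if l \<in> I then 0 else x l)"

definition projection_sum :: "nat set \<Rightarrow> (nat \<Rightarrow> nat) set \<Rightarrow> nat" where
  "projection_sum A X = (\<Sum>I\<in>Pow A. 2 ^ card I * card (zero_out I ` X))"

definition zeros :: "nat set \<Rightarrow> (nat \<Rightarrow> nat) \<Rightarrow> nat" where
  "zeros A x = card {l \<in> A. x l = 0}"

definition weight :: "nat set \<Rightarrow> (nat \<Rightarrow> nat) set \<Rightarrow> nat" where
  "weight A X = (\<Sum>x\<in>X. 3 ^ zeros A x)"

text \<open>The binomial expansion of \<open>(1 + 2)\<^sup>m\<close>, grouped by subsets.\<close>
lemma sum_Pow_power2:
  "finite Z \<Longrightarrow> (\<Sum>I\<in>Pow Z. 2 ^ card I) = (3::nat) ^ card Z"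
proof (induction rule: finite_induct)
  case (insert z Z)
  have "(\<Sum>I\<in>insert z ` Pow Z. 2 ^ card I) = (\<Sum>I\<in>Pow Z. 2 ^ card (insert z I))"
    using insert(2) by (subst sum.reindex) (auto simp: inj_on_def insert_ident)
  also have "\<dots> = (\<Sum>I\<in>Pow Z. 2 * (2::nat) ^ card I)"
  proof (rule sum.cong)
    fix I assume "I \<in> Pow Z"
    then have "finite I" "z \<notin> I" using insert(1,2) by (auto intro: finite_subset)
    then show "(2::nat) ^ card (insert z I) = 2 * 2 ^ card I" by simp
  qed simp
  also have "\<dots> = 2 * 3 ^ card Z" by (simp add: sum_distrib_left[symmetric] insert.IH)
  finally have "(\<Sum>I\<in>insert z ` Pow Z. 2 ^ card I) = (2::nat) * 3 ^ card Z" .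
  moreover have "Pow Z \<inter> insert z ` Pow Z = {}" using insert(2) by auto
  ultimately show ?case
    using insert by (simp add: Pow_insert sum.union_disjoint)
qed simp

lemma down_closed_zero_out:
  assumes "down_closed X"
  shows "zero_out I ` X = {x \<in> X. \<forall>l\<in>I. x l = 0}"
proof (intro equalityI subsetI)
  fix y assume "y \<in> zero_out I ` X"
  then obtain x where x: "x \<in> X" "y = zero_out I x" by blast
  then have "y \<le> x" by (simp add: le_fun_def zero_out_def)
  with x assms show "y \<in> {x \<in> X. \<forall>l\<in>I. x l = 0}" by (auto simp: down_closed_def zero_out_def)
next
  fix x assume x: "x \<in> {x \<in> X. \<forall>l\<in>I. x l = 0}"
  then have "zero_out I x = x" by (auto simp: zero_out_def)
  with x show "x \<in> zero_out I ` X" by (metis (no_types, lifting) image_eqI mem_Collect_eq)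
qed

text \<open>In a down-closed set the projection that deletes \<open>I\<close> can be read off from the points that already
  vanish on \<open>I\<close>. So a point with \<open>z\<close> zeros is counted once for each set \<open>I\<close> of its zero coordinates,
  with weight \<open>2\<^bsup>|I|\<^esup>\<close>, and this adds up to \<open>3\<^sup>z\<close>.\<close>
lemma projection_sum_down_closed:
  assumes "finite A" "finite X" "down_closed X"
  shows "projection_sum A X = weight A X"
proof -
  have "projection_sum A X = (\<Sum>I\<in>Pow A. \<Sum>x\<in>X. if \<forall>l\<in>I. x l = 0 then 2 ^ card I else 0)"
    unfolding projection_sum_def
  proof (rule sum.cong)
    fix I
    have "(\<Sum>x\<in>X. if \<forall>l\<in>I. x l = 0 then 2 ^ card I else 0) = 
        (\<Sum>x\<in>{x \<in> X. \<forall>l\<in>I. x l = 0}. (2::nat) ^ card I)"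
      using assms(2) by (intro sum.inter_filter[symmetric])
    then show "2 ^ card I * card (zero_out I ` X) =
        (\<Sum>x\<in>X. if \<forall>l\<in>I. x l = 0 then 2 ^ card I else 0)"
      by (simp add: down_closed_zero_out[OF assms(3)])
  qed simp
  also have "\<dots> = (\<Sum>x\<in>X. \<Sum>I\<in>Pow A. if \<forall>l\<in>I. x l = 0 then 2 ^ card I else 0)"
    by (rule sum.swap)
  also have "\<dots> = weight A X"
    unfolding weight_def zeros_def
  proof (rule sum.cong)
    fix x
    have "(\<Sum>I\<in>Pow A. if \<forall>l\<in>I. x l = 0 then (2::nat) ^ card I else 0) =
        (\<Sum>I\<in>{I \<in> Pow A. \<forall>l\<in>I. x l = 0}. 2 ^ card I)"
      using assms(1) by (intro sum.inter_filter[symmetric]) simp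
    also have "{I \<in> Pow A. \<forall>l\<in>I. x l = 0} = Pow {l \<in> A. x l = 0}" by auto
    finally show "(\<Sum>I\<in>Pow A. if \<forall>l\<in>I. x l = 0 then (2::nat) ^ card I else 0) =
        3 ^ card {l \<in> A. x l = 0}"
      using assms(1) by (simp add: sum_Pow_power2)
  qed simp
  finally show ?thesis .
qed

definition shift :: "nat \<Rightarrow> nat \<Rightarrow> (nat \<Rightarrow> nat) set \<Rightarrow> (nat \<Rightarrow> nat) \<Rightarrow> nat \<Rightarrow> nat" where
  "shift i c X x = (if x i = Suc c \<and> x(i := c) \<notin> X then x(i := c) else x)"

text \<open>A moved point lands outside \<open>X\<close>, so it cannot collide with a point that stays.\<close>
lemma inj_on_shift: "inj_on (shift i c X) X"
proof (rule inj_onI)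
  fix x y assume xy: "x \<in> X" "y \<in> X" and eq: "shift i c X x = shift i c X y"
  show "x = y"
  proof (cases "x i = Suc c \<and> x(i := c) \<notin> X \<and> y i = Suc c \<and> y(i := c) \<notin> X")
    case True
    then have "x(i := c) = y(i := c)" using eq by (simp add: shift_def)
    then have "x(i := c, i := Suc c) = y(i := c, i := Suc c)" by simp
    with True show ?thesis by (simp, metis fun_upd_triv)
  next
    case False
    with eq xy show ?thesis by (auto simp: shift_def split: if_splits)
  qed
qed

text \<open>Projecting along \<open>i\<close> forgets the shift. Otherwise the projection of the shifted set lies in the
  shift of the projection: when a point of \<open>X\<close> is moved but its projection is not, the place
  it moves to is already occupied in the projection.\<close>
lemma card_zero_out_shift_le:
  assumes "finite X"
  shows "card (zero_out I ` shift i c X ` X) \<le> card (zero_out I ` X)"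
proof (cases "i \<in> I")
  case True
  then have "zero_out I (shift i c X x) = zero_out I x" for x
    by (auto simp: shift_def zero_out_def)
  then have "zero_out I ` shift i c X ` X = zero_out I ` X" by (simp add: image_image)
  then show ?thesis by simp
next
  case False
  let ?P = "zero_out I ` X"
  have upd: "zero_out I (x(i := c)) = (zero_out I x)(i := c)" for x
    using False by (auto simp: zero_out_def)
  have coord: "zero_out I x i = x i" for x using False by (simp add: zero_out_def)
  have "zero_out I (shift i c X x) \<in> shift i c ?P ` ?P" if x: "x \<in> X" for x
  proof (cases "x i = Suc c \<and> x(i := c) \<notin> X")
    case True
    then have eq: "zero_out I (shift i c X x) = (zero_out I x)(i := c)"
      by (simp add: shift_def upd)
    show ?thesis
    proof (cases "(zero_out I x)(i := c) \<in> ?P")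
      case True
      then show ?thesis unfolding eq
        by (intro image_eqI[OF _ True]) (simp add: shift_def)
    next
      case notin: False
      have "shift i c ?P (zero_out I x) = (zero_out I x)(i := c)"
        using True notin coord by (simp add: shift_def)
      then show ?thesis unfolding eq using x by (metis imageI)
    qed
  next
    case False
    have "shift i c ?P (zero_out I x) = zero_out I x"
      using False upd[of x] coord[of x] unfolding shift_def by (metis imageI)
    moreover have "shift i c X x = x" using False by (auto simp: shift_def)
    ultimately show ?thesis using x by (metis imageI)
  qed
  then have "zero_out I ` shift i c X ` X \<subseteq> shift i c ?P ` ?P" by blast
  then have "card (zero_out I ` shift i c X ` X) \<le> card (shift i c ?P ` ?P)"
    using assms by (intro card_mono) auto
  also have "\<dots> = card ?P" by (rule card_image[OF inj_on_shift])
  finally show ?thesis .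
qed

lemma down_closedI:
  assumes A: "A \<subseteq> {..<K}" and X: "X \<subseteq> orthant A"
    and step: "\<And>x i c. x \<in> X \<Longrightarrow> i \<in> A \<Longrightarrow> x i = Suc c \<Longrightarrow> x(i := c) \<in> X"
  shows "down_closed X"
  unfolding down_closed_def
proof (intro ballI allI impI)
  fix x d assume "x \<in> X" "d \<le> x"
  then obtain z where z: "z \<in> X" "d \<le> z"
    and least: "\<And>w. w \<in> X \<and> d \<le> w \<Longrightarrow> code K z \<le> code K w"
    using ex_has_least_nat[of "\<lambda>w. w \<in> X \<and> d \<le> w" x "code K"] by auto
  show "d \<in> X"
  proof (cases "d = z")
    case False
    then obtain l where l: "l \<in> A" "d l < z l" using orthant_less_coord[of z A d] z X by blast
    then obtain c where c: "z l = Suc c" by (cases "z l") auto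
    have "z(l := c) \<in> X" using step z(1) l c by blast
    moreover have "d \<le> z(l := c)" using z(2) l c by (auto simp: le_fun_def)
    moreover have "code K (z(l := c)) < code K z"
      using code_strict_mono[of "z(l := c)" z l K] l c A by (auto simp: le_fun_def)
    ultimately show ?thesis using least[of "z(l := c)"] by simp
  qed (use z in simp)
qed

text \<open>Each shift that moves a point lowers the sum of the codes, so repeated shifting ends, and it can only
  end at a down-closed set.\<close>
lemma down_closed_reduction:
  assumes A: "A \<subseteq> {..<K}"
  shows "X \<subseteq> orthant A \<Longrightarrow> finite X \<Longrightarrow> \<exists>Y. Y \<subseteq> orthant A \<and> finite Y \<and> card Y = card X \<and>
    down_closed Y \<and> projection_sum A Y \<le> projection_sum A X"
proof (induction "sum (code K) X" arbitrary: X rule: less_induct)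
  case less
  show ?case
  proof (cases "down_closed X")
    case True
    with less.prems show ?thesis by blast
  next
    case False
    with down_closedI[OF A less.prems(1)] obtain x i c
      where x: "x \<in> X" "i \<in> A" "x i = Suc c" "x(i := c) \<notin> X" by blast
    let ?Y = "shift i c X ` X"
    have le: "shift i c X y \<le> y" for y by (auto simp: shift_def le_fun_def)
    have "shift i c X x = x(i := c)" using x by (simp add: shift_def)
    then have lt: "code K (shift i c X x) < code K x"
      using code_strict_mono[OF le[of x], of i K] x A by auto
    have "sum (code K) ?Y = (\<Sum>y\<in>X. code K (shift i c X y))"
      by (simp add: sum.reindex[OF inj_on_shift])
    also have "\<dots> < sum (code K) X"
      using x(1) lt code_mono[OF le] less.prems(2) by (intro sum_strict_mono_ex1) auto
    finally have smaller: "sum (code K) ?Y < sum (code K) X" .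
    have "?Y \<subseteq> orthant A" using less.prems(1) orthant_le[OF _ le] by blast
    with less.hyps[OF smaller] less.prems(2) obtain Z where Z: "Z \<subseteq> orthant A" "finite Z"
      "card Z = card ?Y" "down_closed Z" "projection_sum A Z \<le> projection_sum A ?Y" by blast
    have "projection_sum A ?Y \<le> projection_sum A X"
      unfolding projection_sum_def
      using card_zero_out_shift_le[OF less.prems(2)] by (intro sum_mono mult_left_mono) auto
    with Z card_image[OF inj_on_shift, of i c X] show ?thesis by (intro exI[of _ Z]) auto
  qed
qed

section \<open>Compression of slices\<close>

text \<open>The coordinate \<open>i\<close> is set to \<open>0\<close>, so slices at different heights can be compared; \<open>stack\<close> puts them back.\<close>
definition slice :: "nat \<Rightarrow> (nat \<Rightarrow> nat) set \<Rightarrow> nat \<Rightarrow> (nat \<Rightarrow> nat) set" where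
  "slice i X c = (\<lambda>x. x(i := 0)) ` {x \<in> X. x i = c}"

definition stack :: "nat \<Rightarrow> nat set \<Rightarrow> (nat \<Rightarrow> (nat \<Rightarrow> nat) set) \<Rightarrow> (nat \<Rightarrow> nat) set" where
  "stack i C Y = (\<Union>c\<in>C. (\<lambda>y. y(i := c)) ` Y c)"

lemma sum_stack:
  assumes "finite C" "\<And>c. c \<in> C \<Longrightarrow> finite (Y c)" "\<And>c y. c \<in> C \<Longrightarrow> y \<in> Y c \<Longrightarrow> y i = 0"
  shows "sum g (stack i C Y) = (\<Sum>c\<in>C. \<Sum>y\<in>Y c. g (y(i := c)))"
proof -
  have "sum g (stack i C Y) = (\<Sum>c\<in>C. sum g ((\<lambda>y. y(i := c)) ` Y c))"
    unfolding stack_def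
  proof (rule sum.UNION_disjoint)
    show "\<forall>c\<in>C. \<forall>d\<in>C. c \<noteq> d \<longrightarrow> (\<lambda>y. y(i := c)) ` Y c \<inter> (\<lambda>y. y(i := d)) ` Y d = {}"
      by (auto simp: fun_eq_iff) metis
  qed (use assms in auto)
  also have "\<dots> = (\<Sum>c\<in>C. \<Sum>y\<in>Y c. g (y(i := c)))"
  proof (rule sum.cong[OF refl])
    fix c assume c: "c \<in> C"
    have "inj_on (\<lambda>y. y(i := c)) (Y c)"
    proof (rule inj_onI)
      fix x y assume xy: "x \<in> Y c" "y \<in> Y c" and "x(i := c) = y(i := c)"
      then have "x(i := c, i := 0) = y(i := c, i := 0)" by simp
      then show "x = y" using assms(3)[OF c] xy by (simp, metis fun_upd_triv)
    qed
    then show "sum g ((\<lambda>y. y(i := c)) ` Y c) = (\<Sum>y\<in>Y c. g (y(i := c)))"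
      by (simp add: sum.reindex)
  qed
  finally show ?thesis .
qed

lemma slice_iff:
  assumes "y i = 0"
  shows "y \<in> slice i X c \<longleftrightarrow> y(i := c) \<in> X"
proof
  assume "y \<in> slice i X c"
  then obtain x where "x \<in> X" "x i = c" "y = x(i := 0)" by (auto simp: slice_def)
  then have "y(i := c) = x" by (simp add: fun_eq_iff)
  with \<open>x \<in> X\<close> show "y(i := c) \<in> X" by simp
next
  assume X: "y(i := c) \<in> X"
  have "y = (y(i := c))(i := 0)" using assms by (simp add: fun_eq_iff)
  then show "y \<in> slice i X c" unfolding slice_def
    by (rule image_eqI[where f = "\<lambda>x. x(i := 0)"]) (use X in simp)
qed

lemma stack_slices: "stack i ((\<lambda>x. x i) ` X) (slice i X) = X"
proof (intro equalityI subsetI)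
  fix z assume "z \<in> stack i ((\<lambda>x. x i) ` X) (slice i X)"
  then obtain c y where "z = y(i := c)" "y \<in> slice i X c" by (auto simp: stack_def)
  moreover then have "y i = 0" by (auto simp: slice_def)
  ultimately show "z \<in> X" by (simp add: slice_iff)
next
  fix z assume z: "z \<in> X"
  have "z(i := 0) \<in> slice i X (z i)" using z by (simp add: slice_iff)
  moreover have "z = (z(i := 0))(i := z i)" by simp
  ultimately show "z \<in> stack i ((\<lambda>x. x i) ` X) (slice i X)"
    using z unfolding stack_def by blast
qed

lemma slice_orthant: "X \<subseteq> orthant A \<Longrightarrow> slice i X c \<subseteq> orthant (A - {i})"
  by (auto simp: slice_def orthant_def)

lemma slice_down_closed:
  assumes "down_closed X"
  shows "down_closed (slice i X c)"
  unfolding down_closed_def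
proof (intro ballI allI impI)
  fix y d assume y: "y \<in> slice i X c" "d \<le> y"
  then have "y i = 0" by (auto simp: slice_def)
  moreover then have "d i = 0" using y(2) by (metis le_fun_def le_zero_eq)
  moreover have "d(i := c) \<le> y(i := c)" using y(2) by (simp add: le_fun_def)
  ultimately show "d \<in> slice i X c" using y(1) assms by (auto simp: slice_iff down_closed_def)
qed

lemma slice_antimono:
  assumes "down_closed X" "c \<le> d"
  shows "slice i X d \<subseteq> slice i X c"
proof
  fix y assume y: "y \<in> slice i X d"
  then have "y i = 0" by (auto simp: slice_def)
  moreover have "y(i := c) \<le> y(i := d)" using assms(2) by (simp add: le_fun_def)
  ultimately show "y \<in> slice i X c" using y assms(1) by (auto simp: slice_iff down_closed_def)
qed

lemma zeros_upd:
  assumes "finite A" "i \<in> A"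
  shows "zeros A (y(i := c)) = (if c = 0 then 1 else 0) + zeros (A - {i}) y"
proof -
  have "{l \<in> A. (y(i := c)) l = 0} = (if c = 0 then {i} else {}) \<union> {l \<in> A - {i}. y l = 0}"
    using assms(2) by auto
  then show ?thesis using assms(1) by (simp add: zeros_def)
qed

text \<open>All points of a slice change their code by the same amount when the slice is moved to height \<open>c\<close>;
  the equation avoids subtraction of naturals.\<close>
lemma code_upd:
  assumes "i < K" "y i = 0"
  shows "code K (y(i := c)) + 2 ^ key K i 0 = code K y + 2 ^ key K i c"
proof -
  have rest: "(\<Sum>l\<in>{..<K} - {i}. (2::nat) ^ key K l ((y(i := c)) l)) = (\<Sum>l\<in>{..<K} - {i}. 2 ^ key K l (y l))"
    by (rule sum.cong) auto
  have split: "code K z = 2 ^ key K i (z i) + (\<Sum>l\<in>{..<K} - {i}. 2 ^ key K l (z l))" for z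
    using assms(1) unfolding code_def by (subst sum.remove[of _ i]) auto
  show ?thesis using split[of y] split[of "y(i := c)"] rest assms(2) by simp
qed

lemma stack_weight:
  assumes "finite A" "i \<in> A" "finite C" "\<And>c. c \<in> C \<Longrightarrow> finite (Y c)"
    "\<And>c y. c \<in> C \<Longrightarrow> y \<in> Y c \<Longrightarrow> y i = 0"
  shows "weight A (stack i C Y) = (\<Sum>c\<in>C. 3 ^ (if c = 0 then 1 else 0) * weight (A - {i}) (Y c))"
proof -
  have "weight A (stack i C Y) = (\<Sum>c\<in>C. \<Sum>y\<in>Y c. 3 ^ zeros A (y(i := c)))"
    unfolding weight_def by (rule sum_stack) (use assms in auto)
  then show ?thesis
    by (simp add: weight_def sum_distrib_left zeros_upd[OF assms(1,2)] power_add)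
qed

text \<open>Replace every slice \<open>x\<^sub>i = c\<close> by the initial segment of the same size. Slices of a down-closed set
  decrease with \<open>c\<close> and initial segments are nested, so the new set is again down-closed. Its weight
  does not grow, because the weight is a positive combination of the weights of the slices, which are
  optimal by \<open>opt\<close>. The points \<open>u\<close> and \<open>v\<close> witness that the slice \<open>x\<^sub>i = v\<^sub>i\<close> really changes.\<close>
lemma compression_improves:
  assumes A: "A \<subseteq> {..<K}" and i: "i \<in> A" and ne: "A - {i} \<noteq> {}"
    and X: "X \<subseteq> orthant A" "finite X" "down_closed X"
    and opt: "\<And>S T. segment K (A - {i}) S \<Longrightarrow> T \<subseteq> orthant (A - {i}) \<Longrightarrow> finite S \<Longrightarrow> finite T \<Longrightarrow>
      down_closed T \<Longrightarrow> card S = card T \<Longrightarrow> weight (A - {i}) S \<le> weight (A - {i}) T"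
    and v: "v \<in> X" and u: "u \<in> orthant A" "u \<notin> X" "u i = v i" "code K u < code K v"
  shows "\<exists>Y. Y \<subseteq> orthant A \<and> finite Y \<and> down_closed Y \<and> card Y = card X \<and>
    weight A Y \<le> weight A X \<and> sum (code K) Y < sum (code K) X"
proof -
  let ?B = "A - {i}"
  have B: "?B \<subseteq> {..<K}" and iK: "i < K" and finA: "finite A"
    using A i finite_subset by auto
  have "\<forall>n. \<exists>S. segment K ?B S \<and> finite S \<and> card S = n" using segment_exists[OF B ne] by blast
  then obtain seg where seg: "\<And>n. segment K ?B (seg n)" "\<And>n. finite (seg n)" "\<And>n. card (seg n) = n"
    by metis
  define C where "C = (\<lambda>x. x i) ` X"
  define Z where "Z c = seg (card (slice i X c))" for c
  define Y where "Y = stack i C Z"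
  have finC: "finite C" using X by (simp add: C_def)
  have finS: "finite (slice i X c)" for c using X by (simp add: slice_def)
  have S0: "y i = 0" if "y \<in> slice i X c" for y c using that by (auto simp: slice_def)
  have ZB: "Z c \<subseteq> orthant ?B" for c using seg(1) by (auto simp: Z_def segment_def)
  then have Z0: "y i = 0" if "y \<in> Z c" for y c using that by (auto simp: orthant_def)
  have finZ: "finite (Z c)" for c by (simp add: Z_def seg)
  have cardZ: "card (Z c) = card (slice i X c)" for c by (simp add: Z_def seg)
  have Xstack: "X = stack i C (slice i X)" by (simp add: C_def stack_slices)
  have sumX: "sum g X = (\<Sum>c\<in>C. \<Sum>y\<in>slice i X c. g (y(i := c)))" for g :: "(nat \<Rightarrow> nat) \<Rightarrow> nat"
    by (subst Xstack, rule sum_stack) (use finC finS S0 in auto)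
  have sumY: "sum g Y = (\<Sum>c\<in>C. \<Sum>y\<in>Z c. g (y(i := c)))" for g :: "(nat \<Rightarrow> nat) \<Rightarrow> nat"
    unfolding Y_def by (rule sum_stack) (use finC finZ Z0 in auto)
  have "Y \<subseteq> orthant A" using ZB i by (fastforce simp: Y_def stack_def orthant_def)
  moreover have "finite Y" using finC finZ by (simp add: Y_def stack_def)
  moreover have "card Y = card X" using sumX[of "\<lambda>_. 1"] sumY[of "\<lambda>_. 1"] by (simp add: cardZ)
  moreover have "down_closed Y"
    unfolding down_closed_def
  proof (intro ballI allI impI)
    fix x d assume "x \<in> Y" and d: "d \<le> x"
    then obtain c y where c: "c \<in> C" and y: "y \<in> Z c" "x = y(i := c)" by (auto simp: Y_def stack_def)
    have di: "d i \<le> c" using d y by (simp add: le_fun_def) (metis fun_upd_same)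
    obtain x' where "x' \<in> X" "x' i = c" using c by (auto simp: C_def)
    moreover then have "x'(i := d i) \<le> x'" using di by (simp add: le_fun_def)
    ultimately have "x'(i := d i) \<in> X" using X(3) by (auto simp: down_closed_def)
    then have diC: "d i \<in> C" unfolding C_def by (metis fun_upd_same image_eqI)
    have "Z c \<subseteq> Z (d i)"
      using segment_nested[OF B seg(1) seg(1) seg(2) seg(2)] card_mono[OF finS slice_antimono[OF X(3) di]]
      by (simp add: Z_def seg)
    then have "y \<in> Z (d i)" using y by blast
    moreover have "d(i := 0) \<le> y"
      unfolding le_fun_def
    proof
      fix l show "(d(i := 0)) l \<le> y l" using le_funD[OF d, of l] y(2) by (cases "l = i") simp_all
    qed
    moreover have "down_closed (Z (d i))" unfolding Z_def by (rule segment_down_closed[OF B seg(1)])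
    ultimately have "d(i := 0) \<in> Z (d i)" by (auto simp: down_closed_def)
    moreover have "d = (d(i := 0))(i := d i)" by simp
    ultimately show "d \<in> Y" using diC unfolding Y_def stack_def by blast
  qed
  moreover have "weight A Y \<le> weight A X"
  proof -
    have "weight A X = (\<Sum>c\<in>C. 3 ^ (if c = 0 then 1 else 0) * weight ?B (slice i X c))"
      by (subst Xstack, rule stack_weight) (use finA i finC finS S0 in auto)
    moreover have "weight A Y = (\<Sum>c\<in>C. 3 ^ (if c = 0 then 1 else 0) * weight ?B (Z c))"
      unfolding Y_def by (rule stack_weight) (use finA i finC finZ Z0 in auto)
    moreover have "weight ?B (Z c) \<le> weight ?B (slice i X c)" for c
      using opt[OF seg(1) slice_orthant[OF X(1)] seg(2) finS slice_down_closed[OF X(3)]]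
      by (simp add: Z_def seg)
    ultimately show ?thesis by (auto intro!: sum_mono)
  qed
  moreover have "sum (code K) Y < sum (code K) X"
  proof -
    define h where "h c y = code K (y(i := c))" for c y
    have eq: "sum (h c) W + card W * 2 ^ key K i 0 = sum (code K) W + card W * 2 ^ key K i c"
      if "\<And>y. y \<in> W \<Longrightarrow> y i = 0" for c W
    proof -
      have "(\<Sum>y\<in>W. h c y + 2 ^ key K i 0) = (\<Sum>y\<in>W. code K y + 2 ^ key K i c)"
        unfolding h_def using that iK by (intro sum.cong code_upd) auto
      then show ?thesis by (simp add: sum.distrib)
    qed
    have le: "sum (code K) (Z c) \<le> sum (code K) (slice i X c)" for c
      unfolding Z_def using segment_code_sum(1)[OF B seg(1) slice_orthant[OF X(1)] seg(2) finS] seg(3) by simp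
    have le': "sum (h c) (Z c) \<le> sum (h c) (slice i X c)" for c
      using eq[of "Z c" c] eq[of "slice i X c" c] Z0 S0 le[of c] by (simp add: cardZ)
    have vC: "v i \<in> C" using v by (simp add: C_def)
    have "Z (v i) \<noteq> slice i X (v i)"
    proof
      assume eq': "Z (v i) = slice i X (v i)"
      have "v(i := 0) \<in> Z (v i)" unfolding eq' using v by (simp add: slice_iff)
      moreover have "u(i := 0) \<in> orthant ?B" using u(1) by (auto simp: orthant_def)
      moreover have "u(i := v i) = u" by (simp add: fun_eq_iff u(3))
      then have "code K (u(i := 0)) < code K (v(i := 0))"
        using code_upd[OF iK, of "u(i := 0)" "v i"] code_upd[OF iK, of "v(i := 0)" "v i"] u(4) by simp
      ultimately have "u(i := 0) \<in> Z (v i)"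
        using seg(1) unfolding Z_def segment_def by blast
      then have "u(i := 0, i := v i) \<in> X" unfolding eq' by (simp add: slice_iff)
      then show False using u(2) unfolding u(3)[symmetric] by simp
    qed
    then have "sum (code K) (Z (v i)) < sum (code K) (slice i X (v i))"
      unfolding Z_def using segment_code_sum(2)[OF B seg(1) slice_orthant[OF X(1)] seg(2) finS] seg(3) by simp
    then have "sum (h (v i)) (Z (v i)) < sum (h (v i)) (slice i X (v i))"
      using eq[of "Z (v i)" "v i"] eq[of "slice i X (v i)" "v i"] Z0 S0 by (simp add: cardZ)
    then have "(\<Sum>c\<in>C. sum (h c) (Z c)) < (\<Sum>c\<in>C. sum (h c) (slice i X c))"
      using vC le' finC by (intro sum_strict_mono_ex1) auto
    then show ?thesis unfolding sumX sumY h_def .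
  qed
  ultimately show ?thesis by blast
qed

section \<open>Exchanging points and lines\<close>

text \<open>Both exchanges below are of this kind: \<open>h\<close> moves the points of \<open>V\<close> to free places that come
  earlier and carry no more zeros.\<close>
lemma exchange_improves:
  assumes X: "X \<subseteq> orthant A" "finite X"
    and V: "V \<subseteq> X" "V \<noteq> {}" and h: "inj_on h V" "h ` V \<subseteq> orthant A - X"
    and code: "\<And>w. w \<in> V \<Longrightarrow> code K (h w) < code K w"
    and zeros: "\<And>w. w \<in> V \<Longrightarrow> zeros A (h w) \<le> zeros A w"
    and down: "down_closed (X - V \<union> h ` V)"
  shows "\<exists>Y. Y \<subseteq> orthant A \<and> finite Y \<and> down_closed Y \<and> card Y = card X \<and>
    weight A Y \<le> weight A X \<and> sum (code K) Y < sum (code K) X"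
proof -
  let ?Y = "X - V \<union> h ` V"
  have finV: "finite V" using X V finite_subset by blast
  have sumY: "sum g ?Y = sum g (X - V) + (\<Sum>w\<in>V. g (h w))" for g :: "(nat \<Rightarrow> nat) \<Rightarrow> nat"
    using X(2) finV h by (subst sum.union_disjoint) (auto simp: sum.reindex)
  have sumX: "sum g X = sum g (X - V) + sum g V" for g :: "(nat \<Rightarrow> nat) \<Rightarrow> nat"
    using sum.subset_diff[OF V(1) X(2), of g] by simp
  have "card ?Y = card X" using sumX[of "\<lambda>_. 1"] sumY[of "\<lambda>_. 1"] by simp
  moreover have "weight A ?Y \<le> weight A X"
    unfolding weight_def sumX sumY using zeros by (intro add_left_mono sum_mono power_increasing) auto
  moreover have "sum (code K) ?Y < sum (code K) X"
    unfolding sumX sumY using code finV V(2) by (intro add_strict_left_mono sum_strict_mono) auto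
  moreover have "?Y \<subseteq> orthant A" "finite ?Y" using X h finV by auto
  ultimately show ?thesis using down by blast
qed

text \<open>If some slice is not an initial segment, compression applies. Otherwise the least missing point \<open>u\<close>
  and the greatest present point \<open>v\<close> have no common coordinate. Let \<open>i\<close> be the position of their
  greatest differing pair, which belongs to \<open>v\<close>. Then \<open>v\<^sub>l < u\<^sub>l\<close> at all other positions \<open>l\<close>: else \<open>v\<close>
  with the entry \<open>u\<^sub>l\<close> at \<open>l\<close> would lie strictly between \<open>u\<close> and \<open>v\<close> and share a coordinate with both,
  which would force it, and then \<open>u\<close>, into \<open>X\<close>.

  So \<open>u\<close> has no zero except possibly at \<open>i\<close>. If \<open>u\<^sub>i \<noteq> 0\<close>, the point \<open>u\<close> has the least possible weight
  and may replace \<open>v\<close>. If \<open>u\<^sub>i = 0\<close>, the weight of \<open>u\<close> may exceed that of \<open>v\<close>, and whole lines are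
  exchanged instead: with \<open>y = v\<^sub>t\<close> the smallest entry of \<open>v\<close> at a position \<open>t \<noteq> i\<close>, the points
  \<open>v(t := c)\<close> for \<open>c \<le> y\<close> are replaced by the points \<open>u(i := c)\<close>. Both lines begin with a point that
  has a zero at the varying position, and a point of the second line has no further zeros, so the weight does not
  grow. As \<open>y\<close> is smallest, nothing above the first line is present, and what lies below the second line and
  outside it comes before \<open>u\<close>, so it is present already.\<close>
lemma nonsegment_improvable:
  assumes A: "A \<subseteq> {..<K}" and X: "X \<subseteq> orthant A" "finite X" "down_closed X"
    and nonseg: "\<not> segment K A X"
    and opt: "\<And>i S T. i \<in> A \<Longrightarrow> segment K (A - {i}) S \<Longrightarrow> T \<subseteq> orthant (A - {i}) \<Longrightarrow>
      finite S \<Longrightarrow> finite T \<Longrightarrow> down_closed T \<Longrightarrow> card S = card T \<Longrightarrow>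
      weight (A - {i}) S \<le> weight (A - {i}) T"
  shows "\<exists>Y. Y \<subseteq> orthant A \<and> finite Y \<and> down_closed Y \<and> card Y = card X \<and>
    weight A Y \<le> weight A X \<and> sum (code K) Y < sum (code K) X"
    (is ?improvable)
proof (cases "\<exists>x\<in>X. \<exists>w\<in>orthant A - X. code K w < code K x \<and> (\<exists>j\<in>A. w j = x j)")
  case True
  then obtain x w j where xw: "x \<in> X" "w \<in> orthant A" "w \<notin> X" "code K w < code K x"
    and j: "j \<in> A" "w j = x j" by blast
  have "A - {j} \<noteq> {}"
  proof
    assume "A - {j} = {}"
    then have "l \<notin> A" if "l \<noteq> j" for l using that by blast
    moreover have "x \<in> orthant A" using xw(1) X(1) by blast
    ultimately have "w l = x l" for l
      using xw(2) j(2) by (cases "l = j") (auto simp: orthant_def subset_iff)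
    then have "w = x" by (rule ext)
    then show False using xw(1,3) by simp
  qed
  from compression_improves[OF A j(1) this X opt[OF j(1)] xw(1) xw(2,3) j(2) xw(4)] show ?thesis .
next
  case False
  then have stable: "w \<in> X" if "x \<in> X" "w \<in> orthant A" "code K w < code K x" "j \<in> A" "w j = x j" for x w j
    using that by blast
  obtain v0 u0 where 0: "v0 \<in> X" "u0 \<in> orthant A" "u0 \<notin> X" "code K u0 < code K v0"
    using nonseg X(1) by (auto simp: segment_def)
  obtain u where u: "u \<in> orthant A" "u \<notin> X" "code K u \<le> code K u0"
    and least: "\<And>w. w \<in> orthant A \<Longrightarrow> w \<notin> X \<Longrightarrow> code K u \<le> code K w"
    using ex_has_least_nat[of "\<lambda>w. w \<in> orthant A \<and> w \<notin> X" u0 "code K"] 0 by auto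
  have "Max (code K ` X) \<in> code K ` X" using 0(1) X(2) by (intro Max_in) auto
  then obtain v where v: "v \<in> X" "Max (code K ` X) = code K v" by blast
  then have greatest: "code K w \<le> code K v" if "w \<in> X" for w
    using Max_ge[of "code K ` X" "code K w"] that X(2) by simp
  have uv: "code K u < code K v" using u(3) 0 greatest[of v0] by simp
  have vA: "v \<in> orthant A" using v(1) X(1) by blast
  have below_u: "w \<in> X" if "w \<in> orthant A" "code K w < code K u" for w
    using least[of w] that by fastforce
  obtain i where iK: "i < K" "u i \<noteq> v i"
    and top: "\<And>l. l < K \<Longrightarrow> u l \<noteq> v l \<Longrightarrow> key K l (u l) < key K i (v i)"
    using uv unfolding code_less_iff by blast
  have i: "i \<in> A"
  proof (rule ccontr)
    assume "i \<notin> A"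
    then have "u i = 0" "v i = 0" using u(1) vA by (simp_all add: orthant_def)
    with iK(2) show False by simp
  qed
  have differ: "u l \<noteq> v l" if "l \<in> A" for l
    using stable[OF v(1) u(1) uv that] u(2) by blast
  have larger: "v l < u l" if l: "l \<in> A" "l \<noteq> i" for l
  proof (rule ccontr)
    assume "\<not> v l < u l"
    then have less: "u l < v l" using differ[OF l(1)] by simp
    let ?w = "v(l := u l)"
    have wA: "?w \<in> orthant A" using vA l by (simp add: orthant_def)
    have "l < K" using l A by auto
    then have "code K ?w < code K v"
      using less by (intro code_strict_mono[of _ _ l]) (auto simp: le_fun_def)
    then have wX: "?w \<in> X" using stable[OF v(1) wA _ i] l by simp
    \<comment> \<open>The entry \<open>v\<^sub>i\<close> still dominates, as position \<open>i\<close> is untouched.\<close>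
    have "code K u < code K ?w"
      using iK l top by (intro code_lessI[of i]) (auto split: if_splits)
    then have "u \<in> X" using stable[OF wX u(1) _ l(1)] by simp
    with u(2) show False by simp
  qed
  have finA: "finite A" using A finite_subset by blast
  have nonzero: "zeros (A - {i}) u = 0"
    using larger finA unfolding zeros_def by fastforce
  show ?thesis
  proof (cases "u i = 0")
    case False
    have "zeros A u = 0" using nonzero False zeros_upd[OF finA i, of u "u i"] by simp
    moreover have "down_closed (X - {v} \<union> (\<lambda>_. u) ` {v})"
      unfolding down_closed_def
    proof (intro ballI allI impI)
      fix x d assume x: "x \<in> X - {v} \<union> (\<lambda>_. u) ` {v}" and d: "d \<le> x"
      show "d \<in> X - {v} \<union> (\<lambda>_. u) ` {v}"
      proof (cases "d = x")
        case False
        have xA: "x \<in> orthant A" using x X(1) u(1) by blast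
        then obtain l where "l \<in> A" "d l < x l" using orthant_less_coord[OF _ d False] by metis
        then have less: "code K d < code K x" using code_strict_mono[OF d] A by blast
        have "d \<in> X" using x d X(3) below_u[of d] less orthant_le[OF xA d]
          by (auto simp: down_closed_def)
        moreover have "d \<noteq> v" using x less uv greatest[of x] by auto
        ultimately show ?thesis by simp
      qed (use x in simp)
    qed
    ultimately show ?thesis
      using exchange_improves[OF X(1,2), of "{v}" "\<lambda>_. u" K] v(1) u(1,2) uv by auto
  next
    case u0: True
    have "A - {i} \<noteq> {}"
    proof
      assume "A - {i} = {}"
      have "u l \<le> v l" for l
      proof (cases "l = i")
        case False
        with \<open>A - {i} = {}\<close> have "l \<notin> A" by blast
        then show ?thesis using u(1) by (simp add: orthant_def)
      qed (use u0 in simp)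
      then have "u \<le> v" by (simp add: le_fun_def)
      then show False using v(1) u(2) X(3) by (auto simp: down_closed_def)
    qed
    then obtain s where "s \<in> A - {i}" by blast
    then obtain t where t: "t \<in> A" "t \<noteq> i" and t_min: "\<And>l. l \<in> A - {i} \<Longrightarrow> v t \<le> v l"
      using ex_has_least_nat[of "\<lambda>l. l \<in> A - {i}" s v] by auto
    define y where "y = v t"
    have tK: "t < K" using t A by auto
    \<comment> \<open>This separates the lines: at \<open>i\<close> the first has the entry \<open>v\<^sub>i\<close>, the second entries at most \<open>y\<close>.\<close>
    have y_less: "y < v i"
    proof -
      have "u t \<le> v i" using top[OF tK differ[OF t(1)]] key_less_iff[OF tK iK(1)] by auto
      then show ?thesis using larger[OF t] by (simp add: y_def)
    qed
    define V where "V = (\<lambda>c. v(t := c)) ` {..y}"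
    define h where "h w = u(i := w t)" for w :: "nat \<Rightarrow> nat"
    have hV: "h ` V = (\<lambda>c. u(i := c)) ` {..y}"
      by (simp add: V_def h_def image_image)
    have VX: "V \<subseteq> X"
    proof
      fix w assume "w \<in> V"
      then have "w \<le> v" by (auto simp: V_def y_def le_fun_def)
      then show "w \<in> X" using v(1) X(3) by (auto simp: down_closed_def)
    qed
    moreover have "V \<noteq> {}" by (auto simp: V_def)
    moreover have "inj_on h V"
      by (rule inj_onI) (auto simp: V_def h_def dest: fun_upd_eqD)
    moreover have "h ` V \<subseteq> orthant A - X"
    proof
      fix z assume "z \<in> h ` V"
      then obtain c where z: "z = u(i := c)" by (auto simp: hV)
      then have "u \<le> z" by (simp add: le_fun_def u0)
      then have "z \<notin> X" using u(2) X(3) by (auto simp: down_closed_def)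
      then show "z \<in> orthant A - X" using z u(1) i by (auto simp: orthant_def)
    qed
    moreover have "code K (h w) < code K w" if wV: "w \<in> V" for w
    proof -
      obtain c where c: "c \<le> y" "w = v(t := c)" using wV by (auto simp: V_def)
      have "key K l ((h w) l) < key K i (w i)" if "l < K" "(h w) l \<noteq> w l" for l
      proof (cases "l = i")
        case True
        then show ?thesis using c t y_less iK(1) by (simp add: h_def key_less_iff)
      next
        case False
        then have "u l \<noteq> v l" using differ[OF t(1)] that(2) c by (cases "l = t") (auto simp: h_def)
        then show ?thesis using top[OF that(1)] False c t by (simp add: h_def)
      qed
      moreover have "(h w) i \<noteq> w i" using c t y_less by (simp add: h_def)
      ultimately show ?thesis using iK(1) by (intro code_lessI[of i]) auto
    qed
    moreover have "zeros A (h w) \<le> zeros A w" if "w \<in> V" for w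
      using that nonzero by (auto simp: V_def h_def zeros_upd[OF finA i] zeros_upd[OF finA t(1)])
    moreover have "down_closed (X - V \<union> h ` V)"
      unfolding down_closed_def
    proof (intro ballI allI impI)
      fix x d assume "x \<in> X - V \<union> h ` V" and d: "d \<le> x"
      then consider "x \<in> X" "x \<notin> V" | "x \<in> h ` V" by blast
      then show "d \<in> X - V \<union> h ` V"
      proof cases
        case 1
        have "d \<in> X" using 1 d X(3) by (auto simp: down_closed_def)
        moreover have "d \<notin> V"
        proof
          assume "d \<in> V"
          then have ge: "v l \<le> x l" if "l \<noteq> t" for l
            using le_funD[OF d, of l] that by (auto simp: V_def)
          have xA: "x \<in> orthant A" using 1 X(1) by blast
          have "code K v < code K x"
          proof (cases "\<exists>l. l \<noteq> t \<and> v l \<noteq> x l")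
            case True
            then obtain l where l: "l \<noteq> t" "v l < x l" using ge by (metis le_neq_implies_less)
            then have lA: "l \<in> A" using xA by (auto simp: orthant_def intro: ccontr)
            then have lK: "l < K" using A by auto
            \<comment> \<open>Raising an entry outweighs the loss at \<open>t\<close>, since \<open>v\<^sub>t\<close> is smallest.\<close>
            let ?w = "v(t := 0, l := Suc (v l))"
            have "v t \<le> v l" using t_min[of l] lA y_less by (cases "l = i") (auto simp: y_def)
            then have "code K v < code K ?w"
              using l lK tK by (intro code_lessI[of l]) (auto simp: key_less_iff split: if_splits)
            also have "\<dots> \<le> code K x"
              using ge l by (intro code_mono) (auto simp: le_fun_def)
            finally show ?thesis .
          next
            case False
            then have eq: "x = v(t := x t)" by (auto simp: fun_eq_iff)
            have "y < x t"
            proof (rule ccontr)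
              assume "\<not> y < x t"
              then have "x \<in> V" unfolding V_def using eq by (intro image_eqI[of _ _ "x t"]) auto
              with 1 show False by simp
            qed
            then have less: "v t < x t" by (simp add: y_def)
            have "v l \<le> x l" for l using False less by (cases "l = t") auto
            then show ?thesis
              using tK less by (intro code_strict_mono[of _ _ t]) (simp_all add: le_fun_def)
          qed
          with greatest[OF 1(1)] show False by simp
        qed
        ultimately show ?thesis by simp
      next
        case 2
        then obtain c where c: "c \<le> y" "x = u(i := c)" by (auto simp: hV)
        have di: "d i \<le> y" using le_funD[OF d, of i] c by simp
        have du: "d l \<le> u l" if "l \<noteq> i" for l using le_funD[OF d, of l] c that by simp
        show ?thesis
        proof (cases "\<exists>l. l \<noteq> i \<and> d l \<noteq> u l")
          case True
          then obtain l where l: "l \<noteq> i" "d l < u l" using du by (metis le_neq_implies_less)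
          then have lA: "l \<in> A" using u(1) by (auto simp: orthant_def intro: ccontr)
          then have lK: "l < K" using A by auto
          \<comment> \<open>The largest point below the new line whose entry at \<open>l\<close> is less than \<open>u\<^sub>l\<close>.
            It comes before \<open>u\<close> because \<open>y < u\<^sub>l\<close>.\<close>
          let ?w = "u(i := y, l := u l - 1)"
          have dw: "d \<le> ?w" using di du l by (auto simp: le_fun_def)
          have wA: "?w \<in> orthant A" using u(1) i lA by (auto simp: orthant_def)
          have "y < u l" using t_min[of l] larger[OF lA l(1)] lA l(1) by (simp add: y_def)
          then have "code K ?w < code K u"
            using l lK iK(1) by (intro code_lessI[of l]) (auto simp: key_less_iff split: if_splits)
          then have "?w \<in> X" using below_u wA by blast
          then have "d \<in> X" using dw X(3) by (auto simp: down_closed_def)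
          moreover have "d \<notin> V" using di y_less t by (auto simp: V_def)
          ultimately show ?thesis by simp
        next
          case False
          then have "d = u(i := d i)" by (auto simp: fun_eq_iff)
          then show ?thesis unfolding hV using di by (intro UnI2 image_eqI[of _ _ "d i"]) auto
        qed
      qed
    qed
    ultimately show ?thesis using exchange_improves[OF X(1,2), of V h K] by blast
  qed
qed

text \<open>The outer induction makes lower-dimensional segments optimal, as compression requires; the inner
  one repeats the improvement, which lowers the sum of the codes, until a segment is reached.\<close>
lemma segment_optimal:
  assumes "A \<subseteq> {..<K}" "segment K A S" "finite S" "X \<subseteq> orthant A" "finite X" "down_closed X"
    "card S = card X"
  shows "weight A S \<le> weight A X"
  using assms
proof (induction "card A" arbitrary: A S X rule: less_induct)
  case less
  note A = \<open>A \<subseteq> {..<K}\<close> and S = \<open>segment K A S\<close> \<open>finite S\<close>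
  have opt: "weight (A - {i}) S \<le> weight (A - {i}) T"
    if "i \<in> A" "segment K (A - {i}) S" "T \<subseteq> orthant (A - {i})" "finite S" "finite T"
      "down_closed T" "card S = card T" for i S T
    using less.hyps[of "A - {i}" S T] that A finite_subset[OF A]
      psubset_card_mono[of A "A - {i}"] by auto
  from less.prems(4-7) show ?case
  proof (induction "sum (code K) X" arbitrary: X rule: less_induct)
    case (less X)
    show ?case
    proof (cases "segment K A X")
      case True
      then have "S = X"
        using segment_nested[OF A S(1) True S(2) less.prems(2)]
          segment_nested[OF A True S(1) less.prems(2) S(2)] less.prems(4) by simp
      then show ?thesis by simp
    next
      case False
      from nonsegment_improvable[OF A less.prems(1-3) False opt] obtain Y
        where Y: "Y \<subseteq> orthant A" "finite Y" "down_closed Y" "card Y = card X"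
          "weight A Y \<le> weight A X" "sum (code K) Y < sum (code K) X" by blast
      from less.hyps[OF Y(6,1-3)] Y(4,5) less.prems(4) show ?thesis by simp
    qed
  qed
qed

section \<open>From integer lists to \<open>\<nat>\<^sup>k\<close>\<close>

text \<open>The position of an integer in \<open>0, 1, -1, 2, -2, \<dots>\<close>, counted from \<open>0\<close>.\<close>
definition int_rank :: "int \<Rightarrow> nat" where
  "int_rank a = nat (if a > 0 then 2 * a - 1 else - 2 * a)"

definition point :: "nat \<Rightarrow> int list \<Rightarrow> nat \<Rightarrow> nat" where
  "point k u = (\<lambda>l. if l < k then int_rank (u ! l) else 0)"

lemma int_prec_iff: "int_prec a b \<longleftrightarrow> int_rank a < int_rank b"
  by (auto simp: int_prec_def int_rank_def)

lemma int_rank_eq_iff [simp]: "int_rank a = int_rank b \<longleftrightarrow> a = b"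
  by (cases "a > 0"; cases "b > 0") (simp_all add: int_rank_def eq_nat_nat_iff, presburger+)

lemma int_rank_surj: "\<exists>a. int_rank a = n"
proof (cases "even n")
  case True
  then obtain m where "n = 2 * m" by blast
  then show ?thesis by (intro exI[of _ "- int m"]) (simp add: int_rank_def)
next
  case False
  then obtain m where "n = 2 * m + 1" by (rule oddE)
  then show ?thesis by (intro exI[of _ "int m + 1"]) (simp add: int_rank_def)
qed

lemma point_eq_iff:
  assumes "u \<in> lattice k" "v \<in> lattice k"
  shows "point k u = point k v \<longleftrightarrow> u = v"
proof
  assume eq: "point k u = point k v"
  show "u = v"
  proof (rule nth_equalityI)
    fix l assume "l < length u"
    then show "u ! l = v ! l" using fun_cong[OF eq, of l] assms by (simp add: point_def lattice_def)
  qed (use assms in \<open>simp add: lattice_def\<close>)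
qed simp

lemma bij_point: "bij_betw (point k) (lattice k) (orthant {..<k})"
proof (rule bij_betw_imageI)
  show "inj_on (point k) (lattice k)" by (simp add: inj_on_def point_eq_iff)
  show "point k ` lattice k = orthant {..<k}"
  proof (intro equalityI subsetI)
    fix x assume x: "x \<in> orthant {..<k}"
    define u where "u = map (\<lambda>l. SOME a. int_rank a = x l) [0..<k]"
    have "int_rank (SOME a. int_rank a = x l) = x l" for l
      using int_rank_surj by (rule someI_ex)
    then have "point k u = x" using x by (auto simp: point_def u_def orthant_def fun_eq_iff)
    moreover have "u \<in> lattice k" by (simp add: u_def lattice_def)
    ultimately show "x \<in> point k ` lattice k" by blast
  qed (auto simp: point_def orthant_def)
qed

text \<open>The order of codes in terms of entries: the greatest differing pair of entry and position, where a
  smaller position counts as greater, belongs to \<open>y\<close>.\<close>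
definition colex_less :: "nat \<Rightarrow> (nat \<Rightarrow> nat) \<Rightarrow> (nat \<Rightarrow> nat) \<Rightarrow> bool" where
  "colex_less k x y \<longleftrightarrow>
    (\<exists>j<k. x j \<noteq> y j \<and> (\<forall>l<k. x l \<noteq> y l \<longrightarrow> x l < y j \<or> x l = y j \<and> j < l))"

lemma code_less_iff_colex_less: "code k x < code k y \<longleftrightarrow> colex_less k x y"
  unfolding code_less_iff colex_less_def by (auto simp: key_less_iff)

text \<open>The position in the full list of the entry at \<open>l\<close> of the list with coordinate \<open>i\<close> deleted.\<close>
definition skip :: "nat \<Rightarrow> nat \<Rightarrow> nat" where
  "skip i l = (if l < i then l else Suc l)"

text \<open>A coordinate on which two points agree is invisible to the order, and deleting it keeps the relative
  order of the remaining positions.\<close>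
lemma colex_less_skip:
  assumes i: "i < Suc k" and eq: "x i = y i"
  shows "colex_less k (x \<circ> skip i) (y \<circ> skip i) \<longleftrightarrow> colex_less (Suc k) x y"
proof -
  have mono: "skip i j < skip i l \<longleftrightarrow> j < l" for j l by (auto simp: skip_def)
  have bound: "l < k \<Longrightarrow> skip i l < Suc k" for l by (auto simp: skip_def)
  have onto: "\<exists>m<k. l = skip i m" if "l < Suc k" "x l \<noteq> y l" for l
  proof (cases "l < i")
    case True
    then show ?thesis using i by (intro exI[of _ l]) (simp add: skip_def)
  next
    case False
    moreover have "l \<noteq> i" using that(2) eq by metis
    ultimately have "\<not> l - 1 < i" "Suc (l - 1) = l" "l - 1 < k" using that(1) by linarith+
    then show ?thesis by (intro exI[of _ "l - 1"]) (simp add: skip_def)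
  qed
  show ?thesis
  proof
    assume "colex_less k (x \<circ> skip i) (y \<circ> skip i)"
    then obtain j where j: "j < k" "x (skip i j) \<noteq> y (skip i j)"
      and top: "\<And>m. m < k \<Longrightarrow> x (skip i m) \<noteq> y (skip i m) \<Longrightarrow>
        x (skip i m) < y (skip i j) \<or> x (skip i m) = y (skip i j) \<and> j < m"
      by (auto simp: colex_less_def)
    have "x l < y (skip i j) \<or> x l = y (skip i j) \<and> skip i j < l"
      if l: "l < Suc k" "x l \<noteq> y l" for l
    proof -
      obtain m where "m < k" "l = skip i m" using onto[OF l] by blast
      then show ?thesis using top[of m] l by (simp add: mono)
    qed
    then show "colex_less (Suc k) x y"
      unfolding colex_less_def using j bound by (intro exI[of _ "skip i j"]) auto
  next
    assume "colex_less (Suc k) x y"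
    then obtain j where j: "j < Suc k" "x j \<noteq> y j"
      and top: "\<And>l. l < Suc k \<Longrightarrow> x l \<noteq> y l \<Longrightarrow> x l < y j \<or> x l = y j \<and> j < l"
      by (auto simp: colex_less_def)
    obtain m where m: "m < k" "j = skip i m" using onto[OF j] by blast
    have "x (skip i l) < y (skip i m) \<or> x (skip i l) = y (skip i m) \<and> m < l"
      if "l < k" "x (skip i l) \<noteq> y (skip i l)" for l
      using top[OF bound[OF that(1)] that(2)] m by (simp add: mono)
    then show "colex_less k (x \<circ> skip i) (y \<circ> skip i)"
      unfolding colex_less_def using m j by (intro exI[of _ m]) auto
  qed
qed

text \<open>The defining recursion of the order of the problem, with \<open>i\<close> and \<open>i'\<close> the first positions of the
  maxima. If maxima or positions differ, the greater of the pairs \<open>(x i, i)\<close> and \<open>(y i', i')\<close> is the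
  greatest differing pair; if both agree, the coordinate cancels.\<close>
lemma colex_less_first_max:
  assumes i: "i < Suc k" "\<And>l. l < Suc k \<Longrightarrow> x l \<le> x i" "\<And>l. l < i \<Longrightarrow> x l < x i"
    and i': "i' < Suc k" "\<And>l. l < Suc k \<Longrightarrow> y l \<le> y i'" "\<And>l. l < i' \<Longrightarrow> y l < y i'"
  shows "colex_less (Suc k) x y \<longleftrightarrow> x i < y i' \<or> x i = y i' \<and> i' < i \<or>
    x i = y i' \<and> i = i' \<and> colex_less k (x \<circ> skip i) (y \<circ> skip i')"
proof -
  consider "x i < y i'" | "y i' < x i" | "x i = y i'" "i' < i" | "x i = y i'" "i < i'"
    | "x i = y i'" "i = i'" by linarith
  then show ?thesis
  proof cases
    case 1
    then have "x l < y i'" if "l < Suc k" for l using i(2)[OF that] by simp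
    with 1 show ?thesis unfolding colex_less_def using i'(1) by force
  next
    case 2
    have "\<not> colex_less (Suc k) x y"
    proof
      assume "colex_less (Suc k) x y"
      then obtain j where "j < Suc k"
        and top: "\<And>l. l < Suc k \<Longrightarrow> x l \<noteq> y l \<Longrightarrow> x l < y j \<or> x l = y j \<and> j < l"
        by (auto simp: colex_less_def)
      moreover have "x i \<noteq> y i" using i'(2)[OF i(1)] 2 by simp
      ultimately show False using top[OF i(1)] i'(2)[of j] 2 by simp
    qed
    with 2 show ?thesis by simp
  next
    case 3
    have "x l < y i' \<or> x l = y i' \<and> i' < l" if "l < Suc k" for l
      using i(2)[OF that] i(3)[of l] 3 by (cases "l < i") auto
    moreover have "x i' \<noteq> y i'" using i(3)[of i'] 3 by simp
    ultimately have "colex_less (Suc k) x y"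
      unfolding colex_less_def using i'(1) by blast
    with 3 show ?thesis by simp
  next
    case 4
    have "\<not> colex_less (Suc k) x y"
    proof
      assume "colex_less (Suc k) x y"
      then obtain j where "j < Suc k"
        and top: "\<And>l. l < Suc k \<Longrightarrow> x l \<noteq> y l \<Longrightarrow> x l < y j \<or> x l = y j \<and> j < l"
        by (auto simp: colex_less_def)
      moreover have "x i \<noteq> y i" using i'(3)[of i] 4 by simp
      ultimately show False using top[OF i(1)] i'(2)[of j] i'(3)[of j] 4 by auto
    qed
    with 4 show ?thesis by simp
  next
    case 5
    then show ?thesis using colex_less_skip[OF i(1), of x y] by simp
  qed
qed

lemma max_entry:
  assumes "u \<noteq> []"
  shows "max_entry u \<in> set u" and "x \<in> set u \<Longrightarrow> int_rank x \<le> int_rank (max_entry u)"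
proof -
  have "Max (int_rank ` set u) \<in> int_rank ` set u" using assms by (intro Max_in) auto
  then obtain m where m: "m \<in> set u" "Max (int_rank ` set u) = int_rank m" by blast
  have le: "int_rank x \<le> int_rank m" if "x \<in> set u" for x
    using Max_ge[of "int_rank ` set u" "int_rank x"] that m by simp
  have "max_entry u = m"
    unfolding max_entry_def
  proof (rule the_equality)
    show "m \<in> set u \<and> (\<forall>x\<in>set u. x = m \<or> int_prec x m)"
      using m(1) le by (metis int_prec_iff int_rank_eq_iff le_neq_implies_less)
  next
    fix m' assume m': "m' \<in> set u \<and> (\<forall>x\<in>set u. x = m' \<or> int_prec x m')"
    then have "m = m' \<or> int_rank m < int_rank m'" using m(1) by (auto simp: int_prec_iff)
    then show "m' = m" using le[of m'] m' by auto
  qed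
  then show "max_entry u \<in> set u" "x \<in> set u \<Longrightarrow> int_rank x \<le> int_rank (max_entry u)"
    using m le by auto
qed

lemma max_index:
  assumes "u \<noteq> []"
  shows "max_index u < length u" and "u ! max_index u = max_entry u"
    and "l < length u \<Longrightarrow> int_rank (u ! l) \<le> int_rank (u ! max_index u)"
    and "l < max_index u \<Longrightarrow> int_rank (u ! l) < int_rank (u ! max_index u)"
proof -
  have "\<exists>i. i < length u \<and> u ! i = max_entry u"
    using max_entry(1)[OF assms] by (simp add: in_set_conv_nth)
  from LeastI_ex[OF this]
  show i: "max_index u < length u" "u ! max_index u = max_entry u" by (auto simp: max_index_def)
  show le: "int_rank (u ! l) \<le> int_rank (u ! max_index u)" if "l < length u" for l
    using that max_entry(2)[OF assms, of "u ! l"] i(2) by simp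
  assume l: "l < max_index u"
  then have "u ! l \<noteq> max_entry u"
    using not_less_Least[of l "\<lambda>i. i < length u \<and> u ! i = max_entry u"] i(1)
    by (auto simp: max_index_def)
  then show "int_rank (u ! l) < int_rank (u ! max_index u)"
    using le[of l] l i by (auto intro: le_neq_implies_less)
qed

lemma colex_less_cong:
  assumes "\<And>l. l < k \<Longrightarrow> x l = x' l" "\<And>l. l < k \<Longrightarrow> y l = y' l"
  shows "colex_less k x y \<longleftrightarrow> colex_less k x' y'"
  using assms by (simp add: colex_less_def cong: conj_cong)

lemma point_delete_coord:
  assumes "u \<in> lattice (Suc k)" "i < Suc k" "l < k"
  shows "point k (delete_coord i u) l = (point (Suc k) u \<circ> skip i) l"
  using assms by (auto simp: point_def delete_coord_def nth_append skip_def lattice_def)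

lemma prec_iff_colex_less:
  assumes "k \<ge> 1" "u \<in> lattice k" "v \<in> lattice k"
  shows "prec k u v \<longleftrightarrow> colex_less k (point k u) (point k v)"
  using assms
proof (induction k u v rule: prec.induct)
  case (2 u v)
  then show ?case by (auto simp: colex_less_def point_def int_prec_iff)
next
  case (3 k u v)
  let ?N = "Suc (Suc k)"
  have ne: "u \<noteq> []" "v \<noteq> []" and len: "length u = ?N" "length v = ?N"
    using 3(3,4) by (auto simp: lattice_def)
  define i where "i = max_index u"
  define i' where "i' = max_index v"
  have i: "i < ?N" "max_entry u = u ! i" and i': "i' < ?N" "max_entry v = v ! i'"
    using max_index(1,2)[OF ne(1)] max_index(1,2)[OF ne(2)] len by (simp_all add: i_def i'_def)
  have del: "delete_coord i u \<in> lattice (Suc k)" "delete_coord i' v \<in> lattice (Suc k)"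
    using i i' len by (auto simp: delete_coord_def lattice_def)
  have "colex_less ?N (point ?N u) (point ?N v) \<longleftrightarrow>
    point ?N u i < point ?N v i' \<or> point ?N u i = point ?N v i' \<and> i' < i \<or>
    point ?N u i = point ?N v i' \<and> i = i' \<and>
      colex_less (Suc k) (point ?N u \<circ> skip i) (point ?N v \<circ> skip i')"
    using max_index[OF ne(1), folded i_def] max_index[OF ne(2), folded i'_def] len i i'
    by (intro colex_less_first_max) (auto simp: point_def)
  moreover have step: "colex_less (Suc k) (point ?N u \<circ> skip i) (point ?N v \<circ> skip i') \<longleftrightarrow>
      colex_less (Suc k) (point (Suc k) (delete_coord i u)) (point (Suc k) (delete_coord i' v))"
    using point_delete_coord[OF 3(3) i(1)] point_delete_coord[OF 3(4) i'(1)]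
    by (intro colex_less_cong) simp_all
  moreover have "point ?N u i = int_rank (max_entry u)" "point ?N v i' = int_rank (max_entry v)"
    using i i' by (simp_all add: point_def)
  ultimately have "colex_less ?N (point ?N u) (point ?N v) \<longleftrightarrow> int_prec (max_entry u) (max_entry v) \<or>
      max_entry u = max_entry v \<and> i' < i \<or> max_entry u = max_entry v \<and> i = i' \<and>
      colex_less (Suc k) (point (Suc k) (delete_coord i u)) (point (Suc k) (delete_coord i' v))"
    by (simp add: int_prec_iff)
  also have "\<dots> \<longleftrightarrow> prec ?N u v"
    using 3(1) del by (auto simp: i_def i'_def)
  finally show ?case ..
qed simp

lemma nths_eq_iff:
  "length u = length v \<Longrightarrow>
    nths u S = nths v S \<longleftrightarrow> (\<forall>l<length u. l \<in> S \<longrightarrow> u ! l = v ! l)"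
proof (induction u v arbitrary: S rule: list_induct2)
  case (Cons a u b v)
  show ?case
    by (simp add: nths_Cons Cons.IH All_less_Suc2)
qed simp

lemma card_image_eq:
  assumes "\<And>x y. x \<in> X \<Longrightarrow> y \<in> X \<Longrightarrow> f x = f y \<longleftrightarrow> g x = g y"
  shows "card (f ` X) = card (g ` X)"
proof (rule bij_betw_same_card)
  let ?h = "\<lambda>z. g (inv_into X f z)"
  have h: "?h (f x) = g x" if "x \<in> X" for x
    using that assms[of "inv_into X f (f x)" x] by (simp add: inv_into_into f_inv_into_f)
  show "bij_betw ?h (f ` X) (g ` X)"
    by (rule bij_betw_imageI) (auto simp: inj_on_def h assms image_image cong: image_cong)
qed

text \<open>Deleting the entries in \<open>I\<close> and overwriting them by zero identify the same points.\<close>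
lemma weighted_proj_sum_point:
  assumes "X \<subseteq> lattice k"
  shows "weighted_proj_sum k X = real (projection_sum {..<k} (point k ` X))"
proof -
  have "card (proj I X) = card (zero_out I ` point k ` X)" if "I \<subseteq> {..<k}" for I
    unfolding proj_def image_image
  proof (rule card_image_eq)
    fix u v assume "u \<in> X" "v \<in> X"
    then have len: "length u = k" "length v = k" using assms by (auto simp: lattice_def)
    then have "nths u (- I) = nths v (- I) \<longleftrightarrow> (\<forall>l<k. l \<notin> I \<longrightarrow> u ! l = v ! l)"
      by (simp add: nths_eq_iff)
    also have "\<dots> \<longleftrightarrow> zero_out I (point k u) = zero_out I (point k v)"
      by (auto simp: zero_out_def point_def fun_eq_iff)
    finally show "nths u (- I) = nths v (- I) \<longleftrightarrow> zero_out I (point k u) = zero_out I (point k v)" .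
  qed
  then show ?thesis by (simp add: weighted_proj_sum_def projection_sum_def)
qed

lemma initial_segment_point:
  assumes "k \<ge> 1" "S \<subseteq> lattice k"
  shows "initial_segment k S \<longleftrightarrow> segment k {..<k} (point k ` S)"
proof -
  have less: "code k (point k u) < code k (point k v) \<longleftrightarrow> prec k u v"
    if "u \<in> lattice k" "v \<in> lattice k" for u v
    using that assms(1) by (simp add: code_less_iff_colex_less prec_iff_colex_less)
  have mem: "point k u \<in> point k ` S \<longleftrightarrow> u \<in> S" if "u \<in> lattice k" for u
    using that assms(2) by (auto simp: point_eq_iff subset_iff)
  have im: "orthant {..<k} = point k ` lattice k"
    using bij_point by (simp add: bij_betw_def)
  have sub: "point k ` S \<subseteq> point k ` lattice k" using assms(2) by blast
  show ?thesis
    unfolding initial_segment_def segment_def im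
    using assms(2) sub by (auto simp: less mem subset_iff)
qed

theorem corollary2:
  fixes k n :: nat
  assumes "k \<ge> 1" and "n \<ge> 1"
  shows "(\<exists>!S. S \<in> n_subsets k n \<and> initial_segment k S) \<and>
    (\<forall>S. S \<in> n_subsets k n \<and> initial_segment k S \<longrightarrow>
      is_arg_min (weighted_proj_sum k) (\<lambda>X. X \<in> n_subsets k n) S)"
proof (intro conjI allI impI)
  let ?A = "{..<k}"
  have inj: "inj_on (point k) (lattice k)" and im: "point k ` lattice k = orthant ?A"
    using bij_point by (auto simp: bij_betw_def)
  have pt: "point k ` X \<subseteq> orthant ?A" "finite (point k ` X)" "card (point k ` X) = n"
    if "X \<in> n_subsets k n" for X
    using that im card_image[OF inj_on_subset[OF inj]] by (auto simp: n_subsets_def)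
  have seg: "segment k ?A (point k ` S)" if "S \<in> n_subsets k n" "initial_segment k S" for S
    using that initial_segment_point[OF assms(1)] by (simp add: n_subsets_def)
  show "\<exists>!S. S \<in> n_subsets k n \<and> initial_segment k S"
  proof (rule ex_ex1I)
    obtain T where T: "segment k ?A T" "finite T" "card T = n"
      using segment_exists[of ?A k n] assms(1) by (auto simp: lessThan_empty_iff)
    then have "T \<subseteq> point k ` lattice k" using im by (simp add: segment_def)
    then obtain S where S: "S \<subseteq> lattice k" "T = point k ` S" by (auto simp: subset_image_iff)
    have "S \<in> n_subsets k n"
      using S T inj_on_subset[OF inj S(1)] by (auto simp: n_subsets_def card_image finite_image_iff)
    then show "\<exists>S. S \<in> n_subsets k n \<and> initial_segment k S"
      using initial_segment_point[OF assms(1) S(1)] S(2) T(1) by auto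
  next
    fix S T
    assume S: "S \<in> n_subsets k n \<and> initial_segment k S" and T: "T \<in> n_subsets k n \<and> initial_segment k T"
    have "point k ` S = point k ` T"
      using segment_nested[OF _ seg[of S] seg[of T]] segment_nested[OF _ seg[of T] seg[of S]]
        pt[of S] pt[of T] S T by simp
    then show "S = T" using inj_on_image_eq_iff[OF inj] S T by (simp add: n_subsets_def)
  qed
  fix S assume S: "S \<in> n_subsets k n \<and> initial_segment k S"
  have "weighted_proj_sum k S \<le> weighted_proj_sum k X" if X: "X \<in> n_subsets k n" for X
  proof -
    obtain Y where Y: "Y \<subseteq> orthant ?A" "finite Y" "card Y = n" "down_closed Y"
      "projection_sum ?A Y \<le> projection_sum ?A (point k ` X)"
      using down_closed_reduction[of ?A k "point k ` X"] pt[OF X] by auto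
    have "projection_sum ?A (point k ` S) = weight ?A (point k ` S)"
      using S pt[of S] segment_down_closed[OF _ seg[of S]] by (simp add: projection_sum_down_closed)
    also have "\<dots> \<le> weight ?A Y"
      using segment_optimal[OF _ seg[of S]] S pt[of S] Y by simp
    also have "\<dots> = projection_sum ?A Y" using Y by (simp add: projection_sum_down_closed)
    also have "\<dots> \<le> projection_sum ?A (point k ` X)" by (rule Y(5))
    finally show ?thesis
      using S X by (simp add: weighted_proj_sum_point n_subsets_def)
  qed
  then show "is_arg_min (weighted_proj_sum k) (\<lambda>X. X \<in> n_subsets k n) S"
    using S by (auto simp: is_arg_min_def not_less)
qed

end
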